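(* Let $\mathcal{G}$ be a finite, connected, simple graph with edge set $\mathcal{E}$, all of whose vertices have degree at least two, regarded as an equilateral quantum graph with every edge identified with $[0,1]$, and let $\mathcal{L}=-d^2/dx^2$ be the Laplacian with Kirchhoff vertex conditions (defined in the context). Let $\omega>0$ and let $m$ be a nonnegative integer. Suppose $z_1$ and $z_2$ are eigenfunctions of $\mathcal{L}$ with common eigenvalue $[\omega+2m\pi]^2$, obtained from eigenfunctions $y_1$ and $y_2$ of $\mathcal{L}$ with common eigenvalue $\omega^2$ by increasing the frequency, that is, $z_j=S_m y_j$ for $j=1,2$, where $S_m$ is the frequency shift defined in the context. If $y_1$ and $y_2$ are orthonormal in $L^2(\mathcal{G})$, then so are $z_1$ and $z_2$.
   Context: Equilateral quantum graph: each edge of $\mathcal{G}$ is given an orientation and identified with the interval $[0,1]$, the endpoints $0,1$ corresponding to the two vertices of the edge. A function $f$ on $\mathcal{G}$ is a collection of components $f_e:[0,1]\to\mathbb{C}$, $e\in\mathcal{E}$. The Hilbert space is $L^2(\mathcal{G})=\bigoplus_{e\in\mathcal{E}}L^2[0,1]$ with inner product $\int_{\mathcal{G}} f\overline{g} = \sum_{e\in\mathcal{E}}\int_0^1 f_e(x)\overline{g_e(x)}\,dx$. The operator $\mathcal{L}$ acts by $\mathcal{L}f=-f''$ on each edge. Its domain consists of the functions that are sufficiently differentiable on each edge (components in the Sobolev space $H^2[0,1]$), continuous on $\mathcal{G}$ (edge components agree at common vertices), and satisfy at each vertex $v$ the Kirchhoff condition: the sum over the edges $e$ incident on $v$ of the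 derivatives of $f_e$ at $v$, taken with respect to local coordinates in which $v$ corresponds to $0$ (i.e. pointing from $v$ into the edge), is zero. $\mathcal{L}$ is self-adjoint on $L^2(\mathcal{G})$. Frequency shift: for $\omega>0$ and a nonnegative integer $m$, $S_m$ sends an eigenfunction $y$ of $\mathcal{L}$ with eigenvalue $\omega^2$, written as $y(x)=A_e\cos(\omega x)+B_e\sin(\omega x)$ on each edge $e\cong[0,1]$, to the function given by $A_e\cos([\omega+2m\pi]x)+B_e\sin([\omega+2m\pi]x)$ on each edge $e$; this is an eigenfunction of $\mathcal{L}$ with eigenvalue $[\omega+2m\pi]^2$. *)

theory Defs
  imports "HOL-Analysis.Analysis" "Graph_Theory.Graph_Theory"
begin

text \<open>
  A finite simple graph is a \<^locale>\<open>pair_graph\<close>: every undirected edge \<open>{u, v}\<close> occurs as the two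
  arcs \<open>(u, v)\<close> and \<open>(v, u)\<close>.  An orientation selects one of them, and the selected arcs serve as
  the edges: \<open>e = (u, v)\<close> is a copy of \<open>[0,1]\<close> with \<open>0\<close> at \<open>u\<close> and \<open>1\<close> at \<open>v\<close>.
\<close>

definition orientation_of :: "'v pair_pre_digraph \<Rightarrow> ('v \<times> 'v) set \<Rightarrow> bool" where
  "orientation_of G E \<longleftrightarrow>
     E \<subseteq> parcs G \<and> (\<forall>u v. (u, v) \<in> parcs G \<longrightarrow> ((u, v) \<in> E \<longleftrightarrow> (v, u) \<notin> E))"

text \<open>
  A function on the quantum graph is given by its components; only the values of \<open>f e\<close> on
  \<open>{0..1}\<close> for edges \<open>e \<in> E\<close> are meaningful.
\<close>

type_synonym 'v qg_fun = "'v \<times> 'v \<Rightarrow> real \<Rightarrow> complex"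

definition qg_eq :: "('v \<times> 'v) set \<Rightarrow> 'v qg_fun \<Rightarrow> 'v qg_fun \<Rightarrow> bool" where
  "qg_eq E f g \<longleftrightarrow> (\<forall>e\<in>E. \<forall>x\<in>{0..1}. f e x = g e x)"

definition qg_ae_eq :: "('v \<times> 'v) set \<Rightarrow> 'v qg_fun \<Rightarrow> 'v qg_fun \<Rightarrow> bool" where
  "qg_ae_eq E f g \<longleftrightarrow> (\<forall>e\<in>E. AE x in lebesgue_on {0..1}. f e x = g e x)"

definition qg_inner :: "('v \<times> 'v) set \<Rightarrow> 'v qg_fun \<Rightarrow> 'v qg_fun \<Rightarrow> complex" where
  "qg_inner E f g = (\<Sum>e\<in>E. LINT x|lebesgue_on {0..1}. f e x * cnj (g e x))"

definition qg_orthonormal :: "('v \<times> 'v) set \<Rightarrow> 'v qg_fun \<Rightarrow> 'v qg_fun \<Rightarrow> bool" where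
  "qg_orthonormal E f g \<longleftrightarrow> qg_inner E f f = 1 \<and> qg_inner E g g = 1 \<and> qg_inner E f g = 0"

definition L2_unit :: "(real \<Rightarrow> complex) set" where
  "L2_unit = {u. u \<in> borel_measurable (lebesgue_on {0..1}) \<and>
                 integrable (lebesgue_on {0..1}) (\<lambda>x. (cmod (u x))\<^sup>2)}"

text \<open>
  Sobolev functions on \<open>[0,1]\<close> are identified with their continuous representatives: \<open>u\<close> has the
  generalised derivative \<open>v \<in> L\<^sup>2[0,1]\<close> iff \<open>u\<close> is absolutely continuous on \<open>[0,1]\<close> with \<open>u' = v\<close>
  almost everywhere.  In \<open>has_L2_deriv2\<close> the first derivative \<open>v\<close> is itself absolutely continuous, so
  \<open>u\<close> is continuously differentiable on \<open>[0,1]\<close>, with one-sided derivatives at the endpoints.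
\<close>

definition has_L2_deriv :: "(real \<Rightarrow> complex) \<Rightarrow> (real \<Rightarrow> complex) \<Rightarrow> bool" where
  "has_L2_deriv u v \<longleftrightarrow>
     v \<in> L2_unit \<and> (\<forall>x\<in>{0..1}. u x = u 0 + (LINT t|lebesgue_on {0..x}. v t))"

definition has_L2_deriv2 :: "(real \<Rightarrow> complex) \<Rightarrow> (real \<Rightarrow> complex) \<Rightarrow> bool" where
  "has_L2_deriv2 u w \<longleftrightarrow> (\<exists>v. has_L2_deriv u v \<and> has_L2_deriv v w)"

definition H2_unit :: "(real \<Rightarrow> complex) set" where
  "H2_unit = {u. \<exists>w. has_L2_deriv2 u w}"

text \<open>The second derivative is determined up to a null set; any representative is chosen.\<close>

definition L2_deriv2 :: "(real \<Rightarrow> complex) \<Rightarrow> real \<Rightarrow> complex" where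
  "L2_deriv2 u = (SOME w. has_L2_deriv2 u w)"

definition incident_edges :: "('v \<times> 'v) set \<Rightarrow> 'v \<Rightarrow> ('v \<times> 'v) set" where
  "incident_edges E v = {e \<in> E. v = fst e \<or> v = snd e}"

text \<open>The component of \<open>f\<close> on an edge incident on \<open>v\<close>, in the local coordinate with \<open>v\<close> at \<open>0\<close>.\<close>

definition local_comp :: "'v qg_fun \<Rightarrow> 'v \<Rightarrow> 'v \<times> 'v \<Rightarrow> real \<Rightarrow> complex" where
  "local_comp f v e = (if v = fst e then f e else (\<lambda>x. f e (1 - x)))"

definition continuous_at_vertex :: "('v \<times> 'v) set \<Rightarrow> 'v qg_fun \<Rightarrow> 'v \<Rightarrow> bool" where
  "continuous_at_vertex E f v \<longleftrightarrow>
     (\<forall>e\<in>incident_edges E v. \<forall>e'\<in>incident_edges E v. local_comp f v e 0 = local_comp f v e' 0)"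

definition kirchhoff_at_vertex :: "('v \<times> 'v) set \<Rightarrow> 'v qg_fun \<Rightarrow> 'v \<Rightarrow> bool" where
  "kirchhoff_at_vertex E f v \<longleftrightarrow>
     (\<Sum>e\<in>incident_edges E v. vector_derivative (local_comp f v e) (at 0 within {0..1})) = 0"

definition laplacian_dom :: "'v pair_pre_digraph \<Rightarrow> ('v \<times> 'v) set \<Rightarrow> 'v qg_fun set" where
  "laplacian_dom G E =
     {f. (\<forall>e\<in>E. f e \<in> H2_unit) \<and>
         (\<forall>v\<in>pverts G. continuous_at_vertex E f v \<and> kirchhoff_at_vertex E f v)}"

definition laplacian :: "'v qg_fun \<Rightarrow> 'v qg_fun" where
  "laplacian f = (\<lambda>e x. - L2_deriv2 (f e) x)"

definition laplacian_eigenfunction ::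
    "'v pair_pre_digraph \<Rightarrow> ('v \<times> 'v) set \<Rightarrow> complex \<Rightarrow> 'v qg_fun \<Rightarrow> bool" where
  "laplacian_eigenfunction G E c f \<longleftrightarrow>
     f \<in> laplacian_dom G E \<and> \<not> qg_ae_eq E f (\<lambda>e x. 0) \<and>
     qg_ae_eq E (laplacian f) (\<lambda>e x. c * f e x)"

definition trig_comb :: "real \<Rightarrow> complex \<times> complex \<Rightarrow> real \<Rightarrow> complex" where
  "trig_comb \<omega> p x = fst p * complex_of_real (cos (\<omega> * x)) + snd p * complex_of_real (sin (\<omega> * x))"

text \<open>The pair \<open>(A, B)\<close> is unique for \<open>\<omega> > 0\<close>, and exists for components of eigenfunctions.\<close>

definition trig_coeffs :: "real \<Rightarrow> (real \<Rightarrow> complex) \<Rightarrow> complex \<times> complex" where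
  "trig_coeffs \<omega> u = (THE p. \<forall>x\<in>{0..1}. u x = trig_comb \<omega> p x)"

definition freq_shift :: "real \<Rightarrow> nat \<Rightarrow> 'v qg_fun \<Rightarrow> 'v qg_fun" where
  "freq_shift \<omega> m y = (\<lambda>e. trig_comb (\<omega> + 2 * real m * pi) (trig_coeffs \<omega> (y e)))"

end

theory Submission
  imports Defs
begin

text \<open>
  On an edge, the inner product of \<open>A cos \<omega>x + B sin \<omega>x\<close> and \<open>C cos \<omega>x + D sin \<omega>x\<close> is
  \<open>(A C* + B D*) / 2 + Q / (2 \<omega>)\<close>, where \<open>Q\<close> depends on \<open>\<omega>\<close> only through \<open>sin \<omega>\<close> and \<open>cos \<omega>\<close>
  and is therefore unchanged by the frequency shift.  The boundary term
  \<open>f(1) g'(1)* - f(0) g'(0)*\<close> equals \<open>- \<omega> Q\<close>.  Regrouped by vertices,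
  the sum of the boundary terms vanishes because \<open>f\<close> is continuous and \<open>g\<close> satisfies the
  Kirchhoff condition.  Hence the inner product is half the sum of \<open>A C* + B D*\<close> at either frequency.
\<close>

section \<open>Eigenfunctions on an edge\<close>

text \<open>The unit interval has finite measure, so \<open>1 + |v|^2\<close> is integrable and can
  serve as a dominating function. That it dominates \<open>|v|\<close> follows from the square of
  \<open>|v| - 1/2\<close> being nonnegative.\<close>

lemma L2_unit_integrable:
  assumes "v \<in> L2_unit"
  shows "integrable (lebesgue_on {0..1}) v"
proof -
  have m: "v \<in> borel_measurable (lebesgue_on {0..1})"
    and i: "integrable (lebesgue_on {0..1}) (\<lambda>x. (cmod (v x))\<^sup>2)"
    using assms by (auto simp: L2_unit_def)
  have i1: "integrable (lebesgue_on {0..1::real}) (\<lambda>x. 1 + (cmod (v x))\<^sup>2)"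
    by (intro Bochner_Integration.integrable_add i Lebesgue_Measure.integrable_const_ivl)
  have "cmod (v x) \<le> 1 + (cmod (v x))\<^sup>2" for x
    using zero_le_power2[of "cmod (v x) - 1/2"] by (simp add: power2_eq_square algebra_simps)
  then have "AE x in lebesgue_on {0..1}. norm (v x) \<le> norm (1 + (cmod (v x))\<^sup>2)"
    by (intro AE_I2) (smt (verit) real_norm_def zero_le_power2)
  then show ?thesis
    using Bochner_Integration.integrable_bound[OF i1 m] by blast
qed

lemma integrable_on_initial_segment:
  fixes v :: "real \<Rightarrow> complex"
  assumes "integrable (lebesgue_on {0..1}) v" "x \<in> {0..1}"
  shows "integrable (lebesgue_on {0..x}) v"
  using assms integrable_subinterval[of 0 1 v 0 x] by auto

text \<open>Passes from the Bochner integral of the definition to the gauge integral, for which the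
  fundamental theorem of calculus is stated.\<close>

lemma has_L2_deriv_integral:
  assumes "has_L2_deriv u v" "x \<in> {0..1}"
  shows "u x = u 0 + integral {0..x} v"
proof -
  have "integrable (lebesgue_on {0..x}) v"
    using assms by (auto simp: has_L2_deriv_def intro!: integrable_on_initial_segment L2_unit_integrable)
  then have "(LINT t|lebesgue_on {0..x}. v t) = integral {0..x} v"
    by (intro lebesgue_integral_eq_integral) auto
  then show ?thesis
    using assms unfolding has_L2_deriv_def by metis
qed

lemma has_L2_deriv_continuous:
  assumes "has_L2_deriv u v"
  shows "continuous_on {0..1} u"
proof -
  have "v integrable_on {0..1}"
    using assms L2_unit_integrable
    by (auto simp: has_L2_deriv_def intro!: integrable_on_lebesgue_on)
  then have "continuous_on {0..1} (\<lambda>x. u 0 + integral {0..x} v)"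
    by (intro continuous_intros indefinite_integral_continuous_1)
  then show ?thesis
    using has_L2_deriv_integral[OF assms] continuous_on_cong by (metis (no_types, lifting))
qed

text \<open>A generalised derivative is fixed only up to a null set. Exchanging it for a continuous
  representative prepares the step from generalised to classical derivatives.\<close>

lemma has_L2_deriv_cong_AE:
  assumes "has_L2_deriv u v" "AE x in lebesgue_on {0..1}. v x = w x"
    and "continuous_on {0..1} w" "x \<in> {0..1}"
  shows "u x = u 0 + integral {0..x} w"
proof -
  have iv: "integrable (lebesgue_on {0..x}) v"
    using assms by (auto simp: has_L2_deriv_def intro!: integrable_on_initial_segment L2_unit_integrable)
  have "continuous_on {0..x} w"
    using assms by (auto intro: continuous_on_subset)
  then have iw: "integrable (lebesgue_on {0..x}) w"
    by (rule continuous_imp_integrable_real)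
  have "AE t in lebesgue_on {0..x}. v t = w t"
    using assms(2,4) by (auto simp: AE_restrict_space_iff elim!: eventually_mono)
  then have "(LINT t|lebesgue_on {0..x}. v t) = (LINT t|lebesgue_on {0..x}. w t)"
    using iv iw by (intro integral_cong_AE) (auto intro: borel_measurable_integrable)
  also have "\<dots> = integral {0..x} w"
    using iw by (intro lebesgue_integral_eq_integral) auto
  finally show ?thesis
    using assms(1,4) unfolding has_L2_deriv_def by metis
qed

lemma has_vector_derivative_of_integral:
  fixes v :: "real \<Rightarrow> complex"
  assumes "continuous_on {0..1} v" "\<And>x. x \<in> {0..1} \<Longrightarrow> u x = u 0 + integral {0..x} v"
    and "x \<in> {0..1}"
  shows "(u has_vector_derivative v x) (at x within {0..1})"
proof -
  have "((\<lambda>x. u 0 + integral {0..x} v) has_vector_derivative 0 + v x) (at x within {0..1})"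
    using assms(1,3) by (intro has_vector_derivative_add integral_has_vector_derivative) auto
  then show ?thesis
    unfolding add_0_left using assms(3,2) by (rule has_vector_derivative_transform[rotated 2])
qed

section \<open>The harmonic oscillator on the unit interval\<close>

lemma has_vector_derivative_of_real_cos:
  "((\<lambda>x. complex_of_real (cos (\<omega> * x))) has_vector_derivative
      complex_of_real (- \<omega> * sin (\<omega> * x))) (at x within S)"
  by (intro has_vector_derivative_of_real) (auto intro!: derivative_eq_intros)

lemma has_vector_derivative_of_real_sin:
  "((\<lambda>x. complex_of_real (sin (\<omega> * x))) has_vector_derivative
      complex_of_real (\<omega> * cos (\<omega> * x))) (at x within S)"
  by (intro has_vector_derivative_of_real) (auto intro!: derivative_eq_intros)

text \<open>Stated for products of the embedded values, the shape in which a factor 1 is inserted in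
  the calculations below.\<close>

lemma of_real_cos_sin_squared:
  "complex_of_real (cos x) * complex_of_real (cos x)
    + complex_of_real (sin x) * complex_of_real (sin x) = 1"
  by (simp flip: of_real_mult of_real_add)

text \<open>For a solution, the vector \<open>(u, v / \<omega>)\<close> rotates with angular speed
  \<omega>. Its components after rotating back by the angle \<open>\<omega> * x\<close> are
  \<open>P\<close> and \<open>Q\<close>. Both have derivative zero, so they keep their initial
  values \<open>u 0\<close> and \<open>v 0 / \<omega>\<close>, which are the coefficients
  sought.\<close>

lemma harmonic_oscillator_solution:
  fixes u v :: "real \<Rightarrow> complex"
  assumes \<omega>: "\<omega> \<noteq> 0"
    and u: "\<And>x. x \<in> {0..1} \<Longrightarrow> (u has_vector_derivative v x) (at x within {0..1})"
    and v: "\<And>x. x \<in> {0..1} \<Longrightarrow>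
      (v has_vector_derivative - complex_of_real (\<omega>\<^sup>2) * u x) (at x within {0..1})"
    and x: "x \<in> {0..1}"
  shows "u x = trig_comb \<omega> (u 0, v 0 / \<omega>) x"
proof -
  define P where "P = (\<lambda>x. u x * complex_of_real (cos (\<omega> * x))
      - v x * complex_of_real (sin (\<omega> * x) / \<omega>))"
  define Q where "Q = (\<lambda>x. u x * complex_of_real (sin (\<omega> * x))
      + v x * complex_of_real (cos (\<omega> * x) / \<omega>))"
  note dc = has_vector_derivative_of_real_cos and ds = has_vector_derivative_of_real_sin
  have dc': "((\<lambda>x. complex_of_real (cos (\<omega> * x) / \<omega>)) has_vector_derivative
      complex_of_real (- sin (\<omega> * x))) (at x within {0..1})" for x
    using \<omega> by (intro has_vector_derivative_of_real) (auto intro!: derivative_eq_intros)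
  have ds': "((\<lambda>x. complex_of_real (sin (\<omega> * x) / \<omega>)) has_vector_derivative
      complex_of_real (cos (\<omega> * x))) (at x within {0..1})" for x
    using \<omega> by (intro has_vector_derivative_of_real) (auto intro!: derivative_eq_intros)
  have "(P has_vector_derivative 0) (at t within {0..1})" if "t \<in> {0..1}" for t
    unfolding P_def
    by (rule has_vector_derivative_eq_rhs[OF has_vector_derivative_diff[OF
          has_vector_derivative_mult[OF u[OF that] dc] has_vector_derivative_mult[OF v[OF that] ds']]])
       (use \<omega> in \<open>simp add: field_simps power2_eq_square\<close>)
  then obtain p where "\<And>t. t \<in> {0..1} \<Longrightarrow> P t = p"
    using has_vector_derivative_zero_constant[of "{0..1}" P] by auto
  then have P: "P x = P 0" using x by simp
  have "(Q has_vector_derivative 0) (at t within {0..1})" if "t \<in> {0..1}" for t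
    unfolding Q_def
    by (rule has_vector_derivative_eq_rhs[OF has_vector_derivative_add[OF
          has_vector_derivative_mult[OF u[OF that] ds] has_vector_derivative_mult[OF v[OF that] dc']]])
       (use \<omega> in \<open>simp add: field_simps power2_eq_square\<close>)
  then obtain q where "\<And>t. t \<in> {0..1} \<Longrightarrow> Q t = q"
    using has_vector_derivative_zero_constant[of "{0..1}" Q] by auto
  then have Q: "Q x = Q 0" using x by simp
  \<comment> \<open>Undoes the rotation: the inserted factor 1 splits \<open>u x\<close> into its
    \<open>P\<close> and \<open>Q\<close> parts, and the terms with \<open>v x\<close>
    cancel.\<close>
  have "u x = u x * (complex_of_real (cos (\<omega> * x)) * complex_of_real (cos (\<omega> * x))
      + complex_of_real (sin (\<omega> * x)) * complex_of_real (sin (\<omega> * x)))"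
    by (simp add: of_real_cos_sin_squared)
  also have "\<dots> = P x * complex_of_real (cos (\<omega> * x)) + Q x * complex_of_real (sin (\<omega> * x))"
    by (simp add: P_def Q_def algebra_simps)
  also have "\<dots> = trig_comb \<omega> (u 0, v 0 / \<omega>) x"
    unfolding P Q by (simp add: P_def Q_def trig_comb_def)
  finally show ?thesis .
qed

text \<open>The eigenvalue equation holds only almost everywhere, but its right-hand side is
  continuous. Hence the first derivative is the integral of a continuous function, and the equation
  holds classically at every point of the interval.\<close>

lemma eigenfunction_trig_comb:
  assumes "laplacian_eigenfunction G E (complex_of_real (\<omega>\<^sup>2)) y" "\<omega> \<noteq> 0" "e \<in> E"
  obtains p where "\<And>x. x \<in> {0..1} \<Longrightarrow> y e x = trig_comb \<omega> p x"
proof -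
  define w where "w = L2_deriv2 (y e)"
  \<comment> \<open>Membership in the domain supplies a second derivative, so the choice made by
    \<open>L2_deriv2\<close> satisfies its specification.\<close>
  have "\<exists>w. has_L2_deriv2 (y e) w"
    using assms by (auto simp: laplacian_eigenfunction_def laplacian_dom_def H2_unit_def)
  then have "has_L2_deriv2 (y e) w"
    unfolding w_def L2_deriv2_def by (rule someI_ex)
  then obtain v where u: "has_L2_deriv (y e) v" and v: "has_L2_deriv v w"
    by (auto simp: has_L2_deriv2_def)
  have "AE x in lebesgue_on {0..1}. - w x = complex_of_real (\<omega>\<^sup>2) * y e x"
    using assms by (simp add: laplacian_eigenfunction_def qg_ae_eq_def laplacian_def w_def)
  then have ae: "AE x in lebesgue_on {0..1}. w x = - complex_of_real (\<omega>\<^sup>2) * y e x"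
    by eventually_elim (metis minus_minus mult_minus_left)
  have cu: "continuous_on {0..1} (\<lambda>x. - complex_of_real (\<omega>\<^sup>2) * y e x)"
    by (intro continuous_intros has_L2_deriv_continuous[OF u])
  show ?thesis
  proof (rule that, rule harmonic_oscillator_solution[OF \<open>\<omega> \<noteq> 0\<close>])
    show "(y e has_vector_derivative v x) (at x within {0..1})" if "x \<in> {0..1}" for x
      using has_L2_deriv_continuous[OF v] has_L2_deriv_integral[OF u] that
      by (rule has_vector_derivative_of_integral)
    show "(v has_vector_derivative - complex_of_real (\<omega>\<^sup>2) * y e x) (at x within {0..1})"
      if "x \<in> {0..1}" for x
      using cu has_L2_deriv_cong_AE[OF v ae cu] that
      by (rule has_vector_derivative_of_integral)
  qed
qed

section \<open>Uniqueness of the trigonometric coefficients\<close>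

lemma trig_comb_inject:
  assumes "\<omega> > 0" "\<And>x. x \<in> {0..1} \<Longrightarrow> trig_comb \<omega> p x = trig_comb \<omega> q x"
  shows "p = q"
proof -
  \<comment> \<open>A point of the interval with \<open>0 < \<omega> * x \<le> 1 < pi\<close>, so
    that the sine is positive there. The endpoint 1 would not do for every \<omega>, since
    \<open>sin \<omega>\<close> may vanish. The cosine coefficient is read off at 0.\<close>
  define x where "x = min 1 (1 / \<omega>)"
  have x: "x \<in> {0..1}" "0 < \<omega> * x" "\<omega> * x \<le> 1"
    using assms(1) by (auto simp: x_def min_def field_simps)
  then have "sin (\<omega> * x) > 0"
    using pi_gt3 by (intro sin_gt_zero) auto
  moreover have "fst p = fst q"
    using assms(2)[of 0] by (simp add: trig_comb_def)
  moreover have "trig_comb \<omega> p x = trig_comb \<omega> q x"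
    using assms(2) x by blast
  ultimately show ?thesis
    by (simp add: trig_comb_def prod_eq_iff)
qed

text \<open>Existence and uniqueness together make the definite description in
  \<open>trig_coeffs\<close> denote the actual coefficients.\<close>

lemma eigenfunction_trig_coeffs:
  assumes "laplacian_eigenfunction G E (complex_of_real (\<omega>\<^sup>2)) y" "\<omega> > 0" "e \<in> E" "x \<in> {0..1}"
  shows "y e x = trig_comb \<omega> (trig_coeffs \<omega> (y e)) x"
proof -
  obtain p where p: "\<And>x. x \<in> {0..1} \<Longrightarrow> y e x = trig_comb \<omega> p x"
    using eigenfunction_trig_comb[OF assms(1) _ assms(3)] assms(2) by auto
  have "trig_coeffs \<omega> (y e) = p"
    unfolding trig_coeffs_def
  proof (rule the_equality)
    show "q = p" if "\<forall>x\<in>{0..1}. y e x = trig_comb \<omega> q x" for q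
      by (rule trig_comb_inject[OF \<open>\<omega> > 0\<close>]) (use that p in auto)
  qed (use p in blast)
  with p assms(4) show ?thesis by simp
qed

section \<open>Boundary terms\<close>

definition trig_deriv :: "real \<Rightarrow> complex \<times> complex \<Rightarrow> real \<Rightarrow> complex" where
  "trig_deriv \<omega> p x = complex_of_real \<omega> *
     (snd p * complex_of_real (cos (\<omega> * x)) - fst p * complex_of_real (sin (\<omega> * x)))"

lemma has_vector_derivative_trig_comb:
  "(trig_comb \<omega> p has_vector_derivative trig_deriv \<omega> p x) (at x within S)"
  unfolding trig_comb_def[abs_def]
  by (rule has_vector_derivative_eq_rhs[OF has_vector_derivative_add[OF
        has_vector_derivative_mult_right[OF has_vector_derivative_of_real_cos]
        has_vector_derivative_mult_right[OF has_vector_derivative_of_real_sin]]])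
     (simp add: trig_deriv_def algebra_simps)

lemma vector_derivative_trig_comb_start:
  assumes "\<And>x. x \<in> {0..1} \<Longrightarrow> u x = trig_comb \<omega> p x"
  shows "vector_derivative u (at 0 within {0..1}) = trig_deriv \<omega> p 0"
proof (rule vector_derivative_within_closed_interval)
  show "(u has_vector_derivative trig_deriv \<omega> p 0) (at 0 within {0..1})"
    by (rule has_vector_derivative_transform[OF _ _ has_vector_derivative_trig_comb]) (auto simp: assms)
qed auto

text \<open>The reflected coordinate puts the terminal vertex at 0, and the chain rule contributes
  the minus sign.\<close>

lemma vector_derivative_trig_comb_end:
  assumes "\<And>x. x \<in> {0..1} \<Longrightarrow> u x = trig_comb \<omega> p x"
  shows "vector_derivative (\<lambda>x. u (1 - x)) (at 0 within {0..1}) = - trig_deriv \<omega> p 1"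
proof (rule vector_derivative_within_closed_interval)
  have "((\<lambda>x. 1 - x) has_vector_derivative - 1) (at (0::real) within {0..1})"
    by (auto intro!: derivative_eq_intros)
  from vector_diff_chain_within[OF this has_vector_derivative_trig_comb, of \<omega> p]
  have "((\<lambda>x. trig_comb \<omega> p (1 - x)) has_vector_derivative - trig_deriv \<omega> p 1) (at 0 within {0..1})"
    by (simp add: o_def)
  then show "((\<lambda>x. u (1 - x)) has_vector_derivative - trig_deriv \<omega> p 1) (at 0 within {0..1})"
    by (rule has_vector_derivative_transform[rotated 2]) (auto simp: assms)
qed auto

text \<open>Double counting of edge ends: the sum over edges of the terms at both ends is a sum over
  vertices of the terms at incident edges. At a vertex the common value of \<open>f\<close> factors
  out and leaves the conjugate of the Kirchhoff sum of \<open>g\<close>.\<close>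

lemma sum_boundary_terms_eq_0:
  fixes f g :: "'v qg_fun"
  assumes fin: "finite V" "finite E" and E: "E \<subseteq> V \<times> V" "\<And>v. (v, v) \<notin> E"
    and cont: "\<And>v. v \<in> V \<Longrightarrow> continuous_at_vertex E f v"
    and kirch: "\<And>v. v \<in> V \<Longrightarrow> kirchhoff_at_vertex E g v"
  shows "(\<Sum>e\<in>E. f e 0 * cnj (vector_derivative (g e) (at 0 within {0..1}))
            + f e 1 * cnj (vector_derivative (\<lambda>x. g e (1 - x)) (at 0 within {0..1}))) = 0"
proof -
  \<comment> \<open>The contribution of the end of \<open>e\<close> that lies at
    \<open>v\<close>.\<close>
  define t where "t v e = local_comp f v e 0 *
    cnj (vector_derivative (local_comp g v e) (at 0 within {0..1}))" for v e
  have vertex: "(\<Sum>e\<in>incident_edges E v. t v e) = 0" if v: "v \<in> V" for v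
  proof (cases "incident_edges E v = {}")
    case False
    then obtain e0 where e0: "e0 \<in> incident_edges E v" by blast
    have "(\<Sum>e\<in>incident_edges E v. t v e) = (\<Sum>e\<in>incident_edges E v. local_comp f v e0 0 *
        cnj (vector_derivative (local_comp g v e) (at 0 within {0..1})))"
    proof (rule sum.cong[OF refl])
      fix e assume "e \<in> incident_edges E v"
      with cont[OF v] e0 have "local_comp f v e 0 = local_comp f v e0 0"
        unfolding continuous_at_vertex_def by blast
      then show "t v e = local_comp f v e0 0 *
          cnj (vector_derivative (local_comp g v e) (at 0 within {0..1}))"
        by (simp add: t_def)
    qed
    also have "\<dots> = local_comp f v e0 0 * cnj (\<Sum>e\<in>incident_edges E v.
        vector_derivative (local_comp g v e) (at 0 within {0..1}))"
      by (simp add: sum_distrib_left)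
    also have "\<dots> = 0"
      using kirch[OF v] by (simp add: kirchhoff_at_vertex_def)
    finally show ?thesis .
  qed simp
  have edge: "(\<Sum>v\<in>{v\<in>V. v = fst e \<or> v = snd e}. t v e) =
      f e 0 * cnj (vector_derivative (g e) (at 0 within {0..1}))
        + f e 1 * cnj (vector_derivative (\<lambda>x. g e (1 - x)) (at 0 within {0..1}))"
    if "e \<in> E" for e
  proof -
    \<comment> \<open>Distinct ends give the sum two terms. They also make \<open>local_comp\<close>
      use the reflected coordinate at \<open>snd e\<close>, as it tests \<open>fst e\<close>
      first.\<close>
    have ne: "fst e \<noteq> snd e" using E(2)[of "fst e"] that by (metis prod.collapse)
    have "{v\<in>V. v = fst e \<or> v = snd e} = {fst e, snd e}"
      using E(1) that by (auto simp: mem_Times_iff)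
    with ne show ?thesis by (simp add: t_def local_comp_def)
  qed
  have "(\<Sum>e\<in>E. \<Sum>v\<in>{v\<in>V. v = fst e \<or> v = snd e}. t v e)
      = (\<Sum>v\<in>V. \<Sum>e\<in>incident_edges E v. t v e)"
    unfolding incident_edges_def using fin(2,1) by (rule sum.swap_restrict)
  then show ?thesis
    using edge vertex by simp
qed

section \<open>Inner products\<close>

text \<open>The mean, over a full period, of one trigonometric combination times the conjugate of
  the other; it is the same at every positive frequency.\<close>

definition mean_term :: "complex \<times> complex \<Rightarrow> complex \<times> complex \<Rightarrow> complex" where
  "mean_term p q = (fst p * cnj (fst q) + snd p * cnj (snd q)) / 2"

definition boundary_term :: "real \<Rightarrow> complex \<times> complex \<Rightarrow> complex \<times> complex \<Rightarrow> complex" where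
  "boundary_term \<omega> p q =
     complex_of_real (sin \<omega> * cos \<omega>) * (fst p * cnj (fst q) - snd p * cnj (snd q))
     + complex_of_real ((sin \<omega>)\<^sup>2) * (fst p * cnj (snd q) + snd p * cnj (fst q))"

lemma boundary_term_trig_deriv:
  "complex_of_real \<omega> * boundary_term \<omega> p q =
     trig_comb \<omega> p 0 * cnj (trig_deriv \<omega> q 0) - trig_comb \<omega> p 1 * cnj (trig_deriv \<omega> q 1)"
proof -
  \<comment> \<open>The term at 0 contains no sine or cosine of \<omega>. Multiplying it by the sum
    of their squares turns the claim into a polynomial identity in \<open>sin \<omega>\<close> and
    \<open>cos \<omega>\<close>.\<close>
  have eq: "trig_comb \<omega> p 0 * cnj (trig_deriv \<omega> q 0) =
      complex_of_real \<omega> * fst p * cnj (snd q) * (complex_of_real (cos \<omega>) * complex_of_real (cos \<omega>)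
        + complex_of_real (sin \<omega>) * complex_of_real (sin \<omega>))"
    unfolding of_real_cos_sin_squared by (simp add: trig_comb_def trig_deriv_def)
  show ?thesis
    unfolding eq
    by (simp add: boundary_term_def trig_comb_def trig_deriv_def power2_eq_square algebra_simps)
qed

text \<open>Here the shift has to be by whole periods: \<open>boundary_term\<close> sees the
  frequency only through its sine and cosine.\<close>

lemma boundary_term_shift: "boundary_term (\<omega> + 2 * real m * pi) p q = boundary_term \<omega> p q"
proof -
  have "sin (\<omega> + 2 * real m * pi) = sin \<omega>" "cos (\<omega> + 2 * real m * pi) = cos \<omega>"
    using sin.plus_of_nat[of \<omega> m] cos.plus_of_nat[of \<omega> m] by (simp_all add: algebra_simps)
  then show ?thesis by (simp add: boundary_term_def)
qed

lemma integral_trig_comb_mult_cnj: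
  assumes "\<omega> \<noteq> 0"
  shows "(LINT x|lebesgue_on {0..1}. trig_comb \<omega> p x * cnj (trig_comb \<omega> q x))
    = mean_term p q + boundary_term \<omega> p q / (2 * complex_of_real \<omega>)"
proof -
  let ?h = "\<lambda>x. trig_comb \<omega> p x * cnj (trig_comb \<omega> q x)"
  \<comment> \<open>An antiderivative of \<open>?h\<close> that vanishes at 0. By the double-angle
    formulas the integrand is the mean term plus multiples of \<open>cos (2 * \<omega> * x)\<close>
    and \<open>sin (2 * \<omega> * x)\<close>.\<close>
  define F where "F x = complex_of_real x * mean_term p q +
      (complex_of_real (sin (\<omega> * x) * cos (\<omega> * x) / (2 * \<omega>)) * (fst p * cnj (fst q) - snd p * cnj (snd q))
     + complex_of_real ((sin (\<omega> * x))\<^sup>2 / (2 * \<omega>)) * (fst p * cnj (snd q) + snd p * cnj (fst q)))" for x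
  have d1: "((\<lambda>x. complex_of_real x) has_vector_derivative complex_of_real 1) (at x within {0..1})" for x
    by (intro has_vector_derivative_of_real) (auto intro!: derivative_eq_intros)
  have d2: "((\<lambda>x. complex_of_real (sin (\<omega> * x) * cos (\<omega> * x) / (2 * \<omega>))) has_vector_derivative
      complex_of_real (((cos (\<omega> * x))\<^sup>2 - (sin (\<omega> * x))\<^sup>2) / 2)) (at x within {0..1})" for x
    using assms by (intro has_vector_derivative_of_real)
      (auto intro!: derivative_eq_intros simp: field_simps power2_eq_square)
  have d3: "((\<lambda>x. complex_of_real ((sin (\<omega> * x))\<^sup>2 / (2 * \<omega>))) has_vector_derivative
      complex_of_real (sin (\<omega> * x) * cos (\<omega> * x))) (at x within {0..1})" for x
    using assms by (intro has_vector_derivative_of_real)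
      (auto intro!: derivative_eq_intros simp: field_simps power2_eq_square)
  have dF: "(F has_vector_derivative ?h x) (at x within {0..1})" for x
  proof -
    \<comment> \<open>The constant is expanded by a factor 1, to be compared with the squares of
      sine and cosine in the integrand.\<close>
    have eq: "complex_of_real 1 * mean_term p q = mean_term p q *
        (complex_of_real (cos (\<omega> * x)) * complex_of_real (cos (\<omega> * x))
          + complex_of_real (sin (\<omega> * x)) * complex_of_real (sin (\<omega> * x)))"
      unfolding of_real_cos_sin_squared by simp
    have "complex_of_real 1 * mean_term p q
        + (complex_of_real (((cos (\<omega> * x))\<^sup>2 - (sin (\<omega> * x))\<^sup>2) / 2)
            * (fst p * cnj (fst q) - snd p * cnj (snd q))
          + complex_of_real (sin (\<omega> * x) * cos (\<omega> * x))
            * (fst p * cnj (snd q) + snd p * cnj (fst q))) = ?h x"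
      unfolding eq by (simp add: trig_comb_def mean_term_def power2_eq_square field_simps)
    then show ?thesis
      unfolding F_def[abs_def]
      by (intro has_vector_derivative_eq_rhs[OF has_vector_derivative_add[OF
            has_vector_derivative_mult_left[OF d1] has_vector_derivative_add[OF
            has_vector_derivative_mult_left[OF d2] has_vector_derivative_mult_left[OF d3]]]])
  qed
  have "continuous_on {0..1} ?h"
    unfolding trig_comb_def by (intro continuous_intros)
  then have "integrable (lebesgue_on {0..1}) ?h"
    by (rule continuous_imp_integrable_real)
  then have "(LINT x|lebesgue_on {0..1}. ?h x) = integral {0..1} ?h"
    by (intro lebesgue_integral_eq_integral) auto
  also have "\<dots> = F 1 - F 0"
    by (intro integral_unique fundamental_theorem_of_calculus dF) auto
  also have "\<dots> = mean_term p q + boundary_term \<omega> p q / (2 * complex_of_real \<omega>)"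
    by (simp add: F_def boundary_term_def add_divide_distrib)
  finally show ?thesis .
qed

lemma qg_inner_trig_comb:
  assumes "\<omega> \<noteq> 0"
    and f: "\<And>e x. e \<in> E \<Longrightarrow> x \<in> {0..1} \<Longrightarrow> f e x = trig_comb \<omega> (p e) x"
    and g: "\<And>e x. e \<in> E \<Longrightarrow> x \<in> {0..1} \<Longrightarrow> g e x = trig_comb \<omega> (q e) x"
  shows "qg_inner E f g = (\<Sum>e\<in>E. mean_term (p e) (q e))
    + (\<Sum>e\<in>E. boundary_term \<omega> (p e) (q e)) / (2 * complex_of_real \<omega>)"
proof -
  have "qg_inner E f g = (\<Sum>e\<in>E. LINT x|lebesgue_on {0..1}.
      trig_comb \<omega> (p e) x * cnj (trig_comb \<omega> (q e) x))"
    unfolding qg_inner_def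
    by (intro sum.cong Bochner_Integration.integral_cong) (auto simp: f g)
  then show ?thesis
    by (simp add: integral_trig_comb_mult_cnj[OF assms(1)] sum.distrib sum_divide_distrib)
qed

section \<open>Cancellation over the graph and invariance under the shift\<close>

lemma sum_boundary_term_eq_0:
  assumes "pair_graph G" "orientation_of G E" "\<omega> \<noteq> 0"
    and dom: "f \<in> laplacian_dom G E" "g \<in> laplacian_dom G E"
    and f: "\<And>e x. e \<in> E \<Longrightarrow> x \<in> {0..1} \<Longrightarrow> f e x = trig_comb \<omega> (p e) x"
    and g: "\<And>e x. e \<in> E \<Longrightarrow> x \<in> {0..1} \<Longrightarrow> g e x = trig_comb \<omega> (q e) x"
  shows "(\<Sum>e\<in>E. boundary_term \<omega> (p e) (q e)) = 0"
proof -
  interpret pair_graph G by fact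
  have sub: "E \<subseteq> parcs G" using assms(2) by (simp add: orientation_of_def)
  \<comment> \<open>The minus sign in front of the term at 1 is absorbed by taking the derivative
    into the edge, as the Kirchhoff condition does.\<close>
  have "complex_of_real \<omega> * (\<Sum>e\<in>E. boundary_term \<omega> (p e) (q e)) =
      (\<Sum>e\<in>E. f e 0 * cnj (vector_derivative (g e) (at 0 within {0..1}))
            + f e 1 * cnj (vector_derivative (\<lambda>x. g e (1 - x)) (at 0 within {0..1})))"
    unfolding sum_distrib_left
  proof (rule sum.cong[OF refl])
    fix e assume e: "e \<in> E"
    have "vector_derivative (g e) (at 0 within {0..1}) = trig_deriv \<omega> (q e) 0"
      by (rule vector_derivative_trig_comb_start) (rule g[OF e])
    moreover have "vector_derivative (\<lambda>x. g e (1 - x)) (at 0 within {0..1}) = - trig_deriv \<omega> (q e) 1"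
      by (rule vector_derivative_trig_comb_end) (rule g[OF e])
    ultimately show "complex_of_real \<omega> * boundary_term \<omega> (p e) (q e) =
        f e 0 * cnj (vector_derivative (g e) (at 0 within {0..1}))
          + f e 1 * cnj (vector_derivative (\<lambda>x. g e (1 - x)) (at 0 within {0..1}))"
      using e by (simp add: boundary_term_trig_deriv f)
  qed
  also have "\<dots> = 0"
  proof (rule sum_boundary_terms_eq_0[where V = "pverts G"])
    show "finite E" using sub pair_finite_arcs by (rule finite_subset)
    show "E \<subseteq> pverts G \<times> pverts G"
    proof
      fix e assume "e \<in> E"
      with sub have "e \<in> parcs G" by (rule subsetD)
      then show "e \<in> pverts G \<times> pverts G"
        unfolding mem_Times_iff by (intro conjI arc_fst_in_verts arc_snd_in_verts)
    qed
    \<comment> \<open>A loop in \<open>E\<close> would be its own reversal, and an orientation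
      contains exactly one of an arc and its reversal.\<close>
    show "(v, v) \<notin> E" for v
      using assms(2) unfolding orientation_of_def by blast
    show "continuous_at_vertex E f v" if "v \<in> pverts G" for v
      using dom(1) that unfolding laplacian_dom_def by blast
    show "kirchhoff_at_vertex E g v" if "v \<in> pverts G" for v
      using dom(2) that unfolding laplacian_dom_def by blast
  qed (rule pair_finite_verts)
  finally show ?thesis using \<open>\<omega> \<noteq> 0\<close> by simp
qed

text \<open>The cancellation at \<omega> serves both frequencies: the coefficients are kept and
  \<open>boundary_term\<close> is unchanged by the shift. Both inner products therefore reduce to
  the same sum of mean terms.\<close>

lemma qg_inner_freq_shift:
  assumes G: "pair_graph G" "orientation_of G E" and \<omega>: "\<omega> > 0"
    and f: "laplacian_eigenfunction G E (complex_of_real (\<omega>\<^sup>2)) f"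
    and g: "laplacian_eigenfunction G E (complex_of_real (\<omega>\<^sup>2)) g"
    and f': "qg_eq E f' (freq_shift \<omega> m f)" and g': "qg_eq E g' (freq_shift \<omega> m g)"
  shows "qg_inner E f' g' = qg_inner E f g"
proof -
  let ?p = "\<lambda>e. trig_coeffs \<omega> (f e)" and ?q = "\<lambda>e. trig_coeffs \<omega> (g e)"
  have pos: "\<omega> + 2 * real m * pi > 0"
    using \<omega> by (simp add: add_pos_nonneg)
  have 0: "(\<Sum>e\<in>E. boundary_term \<omega> (?p e) (?q e)) = 0"
    by (rule sum_boundary_term_eq_0[OF G, where f = f and g = g])
       (use \<omega> f g in \<open>auto simp: laplacian_eigenfunction_def
          intro!: eigenfunction_trig_coeffs[OF f] eigenfunction_trig_coeffs[OF g]\<close>)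
  have "qg_inner E f g = (\<Sum>e\<in>E. mean_term (?p e) (?q e))"
    using qg_inner_trig_comb[of \<omega> E f ?p g ?q] \<omega> 0
      eigenfunction_trig_coeffs[OF f \<omega>] eigenfunction_trig_coeffs[OF g \<omega>] by simp
  moreover have "qg_inner E f' g' = (\<Sum>e\<in>E. mean_term (?p e) (?q e))"
    using qg_inner_trig_comb[of "\<omega> + 2 * real m * pi" E f' ?p g' ?q] pos 0 f' g'
    by (simp add: boundary_term_shift qg_eq_def freq_shift_def)
  ultimately show ?thesis by simp
qed

theorem corollary4p5:
  fixes G :: "'v pair_pre_digraph" and E :: "('v \<times> 'v) set"
    and \<omega> :: real and m :: nat and y\<^sub>1 y\<^sub>2 z\<^sub>1 z\<^sub>2 :: "'v qg_fun"
  assumes "pair_graph G"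
    and "Digraph_Component.connected (with_proj G)"
    and "\<forall>v\<in>pverts G. out_degree (with_proj G) v \<ge> 2"
    and "orientation_of G E"
    and "\<omega> > 0"
    and "laplacian_eigenfunction G E (complex_of_real (\<omega>\<^sup>2)) y\<^sub>1"
    and "laplacian_eigenfunction G E (complex_of_real (\<omega>\<^sup>2)) y\<^sub>2"
    and "laplacian_eigenfunction G E (complex_of_real ((\<omega> + 2 * real m * pi)\<^sup>2)) z\<^sub>1"
    and "laplacian_eigenfunction G E (complex_of_real ((\<omega> + 2 * real m * pi)\<^sup>2)) z\<^sub>2"
    and "qg_eq E z\<^sub>1 (freq_shift \<omega> m y\<^sub>1)"
    and "qg_eq E z\<^sub>2 (freq_shift \<omega> m y\<^sub>2)"
    and "qg_orthonormal E y\<^sub>1 y\<^sub>2"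
  shows "qg_orthonormal E z\<^sub>1 z\<^sub>2"
  \<comment> \<open>Invariance of the inner product is applied to the two diagonal pairs and to the
    mixed pair.\<close>
  using assms(12) unfolding qg_orthonormal_def
  by (simp add: qg_inner_freq_shift[OF assms(1,4,5,6,6,10,10)]
      qg_inner_freq_shift[OF assms(1,4,5,7,7,11,11)]
      qg_inner_freq_shift[OF assms(1,4,5,6,7,10,11)])

end
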